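(* Let $q$ be a prime power and $p$ a prime. Assume the MDS conjecture over $\mathbb{F}_q$, in the form: every linear code over $\mathbb{F}_q$ with parameters $[N,K,D]$ satisfying $D=N-K+1$ and $1<K<N-1$ has length $N\le q+2$. If $q$ is not a primitive root modulo $p$ (i.e. the class of $q$ does not generate the multiplicative group $\mathbb{F}_p^\ast$) and $p>q+2$, then $\mu(\mathbb{F}_q,p)\le p$.
   Context: For a positive integer $n$, let $R(\mathbb{F}_q,n)=\mathbb{F}_q[x]/(x^n-1)$, with each class identified with its unique representative of degree $<n$, and with polynomials $\sum_{i=0}^{n-1} f_i x^i$ identified with vectors $(f_0,\dots,f_{n-1})\in\mathbb{F}_q^n$. For $f\in R(\mathbb{F}_q,n)$, $C(f)$ denotes the ideal (cyclic code) of $R(\mathbb{F}_q,n)$ generated by $f$, viewed as a linear code in $\mathbb{F}_q^n$; $d(C(f))$ is its minimum Hamming distance (minimum nonzero Hamming weight) and $\dim C(f)$ its $\mathbb{F}_q$-dimension. Define $\mu(\mathbb{F}_q,n):=\min\{ d(C(f))+\dim C(f) \mid f\in R(\mathbb{F}_q,n),\ f\neq 0\}$. *)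

theory Defs
  imports
    "Jordan_Normal_Form.VS_Connect"
    "HOL-Computational_Algebra.Polynomial"
    "HOL-Library.Cardinality"
    "HOL-Algebra.Ideal"
    "HOL-Number_Theory.Residue_Primitive_Roots"
begin

hide_const (open) Multiset.mult up_ring.monom up_ring.coeff

section \<open>Linear codes\<close>

definition hamming_weight :: "'a :: zero vec \<Rightarrow> nat" where
  "hamming_weight v = card {i. i < dim_vec v \<and> v $ i \<noteq> 0}"

text \<open>Infima are taken in \<^typ>\<open>nat\<close>, so \<^const>\<open>Inf\<close> of a nonempty set is its minimum.  The junk
  value \<open>0\<close> of \<open>min_distance\<close> arises only for codes without nonzero words.\<close>

definition min_distance :: "'a :: zero vec set \<Rightarrow> nat" where
  "min_distance C = Inf {hamming_weight v | v. v \<in> C \<and> v \<noteq> 0\<^sub>v (dim_vec v)}"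

definition code_dim :: "nat \<Rightarrow> 'a :: field vec set \<Rightarrow> nat" where
  "code_dim n C = vectorspace.dim class_ring (module_vec TYPE('a) n\<lparr>carrier := C\<rparr>)"

definition linear_code :: "nat \<Rightarrow> nat \<Rightarrow> nat \<Rightarrow> 'a :: field vec set \<Rightarrow> bool" where
  "linear_code n k d C \<longleftrightarrow>
     VectorSpace.subspace class_ring C (module_vec TYPE('a) n) \<and> code_dim n C = k \<and> min_distance C = d"


section \<open>Cyclic codes\<close>

text \<open>The quotient of the polynomial ring by \<open>x ^ n - 1\<close>, carried by the representatives of degree
  less than \<open>n\<close>.  This is only meaningful for \<open>n > 0\<close>.\<close>

definition cyclic_ring :: "nat \<Rightarrow> 'a :: field poly ring" where
  "cyclic_ring n =
     \<lparr>carrier = {f. degree f < n},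
      mult = (\<lambda>f g. (f * g) mod (monom 1 n - 1)),
      one = 1,
      zero = 0,
      add = (+)\<rparr>"

definition cyclic_code :: "nat \<Rightarrow> 'a :: field poly \<Rightarrow> 'a vec set" where
  "cyclic_code n f = (\<lambda>g. vec n (coeff g)) ` genideal (cyclic_ring n) {f}"

definition \<mu> :: "'a :: field itself \<Rightarrow> nat \<Rightarrow> nat" where
  "\<mu> _ n = Inf {min_distance (cyclic_code n f) + code_dim n (cyclic_code n f) | f :: 'a poly.
                 f \<in> carrier (cyclic_ring n) \<and> f \<noteq> 0}"


section \<open>Well-formedness of the definitions\<close>

lemma degree_monom_minus_1: "n > 0 \<Longrightarrow> degree (monom 1 n - 1 :: 'a :: field poly) = n"
  by (subst diff_conv_add_uminus, subst degree_add_eq_left) (auto simp: degree_monom_eq)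

lemma degree_mod_monom_minus_1:
  assumes "n > 0"
  shows "degree (f mod (monom 1 n - 1 :: 'a :: field poly)) < n"
proof -
  have "monom 1 n - 1 \<noteq> (0 :: 'a poly)"
    using degree_monom_minus_1[OF assms, where 'a = 'a] assms by auto
  from degree_mod_less[OF this, of f] show ?thesis
    using degree_monom_minus_1[OF assms, where 'a = 'a] assms by auto
qed

lemma cring_cyclic_ring:
  assumes "n > 0"
  shows "cring (cyclic_ring n :: 'a :: field poly ring)"
proof (rule cringI)
  let ?R = "cyclic_ring n :: 'a poly ring"
  have mod_id: "f mod (monom 1 n - 1) = f" if "degree f < n" for f :: "'a poly"
    using that degree_monom_minus_1[OF assms, where 'a = 'a] by (simp add: mod_poly_less)
  show "abelian_group ?R"
  proof (rule abelian_groupI)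
    fix x assume "x \<in> carrier ?R"
    thus "\<exists>y\<in>carrier ?R. y \<oplus>\<^bsub>?R\<^esub> x = \<zero>\<^bsub>?R\<^esub>"
      by (intro bexI[of _ "- x"]) (auto simp: cyclic_ring_def)
  qed (use assms in \<open>auto simp: cyclic_ring_def degree_add_less add_ac\<close>)
  show "Group.comm_monoid ?R"
    by (rule Group.comm_monoidI)
       (use assms in \<open>auto simp: cyclic_ring_def degree_mod_monom_minus_1 mod_id mod_mult_left_eq
          mod_mult_right_eq mult_ac\<close>)
  show "(x \<oplus>\<^bsub>?R\<^esub> y) \<otimes>\<^bsub>?R\<^esub> z = x \<otimes>\<^bsub>?R\<^esub> z \<oplus>\<^bsub>?R\<^esub> y \<otimes>\<^bsub>?R\<^esub> z" for x y z
    by (simp add: cyclic_ring_def distrib_right poly_mod_add_left)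
qed

lemma subspace_cyclic_code:
  assumes n: "n > 0" and f: "degree f < n"
  shows "VectorSpace.subspace class_ring (cyclic_code n f) (module_vec TYPE('a :: field) n)"
proof -
  let ?R = "cyclic_ring n :: 'a poly ring" and ?I = "genideal (cyclic_ring n) {f}"
  interpret R: cring ?R by (rule cring_cyclic_ring[OF n])
  have I: "ideal ?I ?R"
    by (rule R.genideal_ideal) (use f in \<open>auto simp: cyclic_ring_def\<close>)
  interpret I: ideal ?I ?R by (rule I)
  interpret V: vec_space "TYPE('a)" n .
  have zero: "0 \<in> ?I" using I.zero_closed by (simp add: cyclic_ring_def)
  have add: "g + h \<in> ?I" if "g \<in> ?I" "h \<in> ?I" for g h
    using I.a_closed[OF that] by (simp add: cyclic_ring_def)
  have scale: "Polynomial.smult c g \<in> ?I" if "g \<in> ?I" for c g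
  proof -
    have "degree g < n" using I.Icarr[OF that] by (simp add: cyclic_ring_def)
    moreover have "[:c:] \<otimes>\<^bsub>?R\<^esub> g \<in> ?I"
      by (rule I.I_l_closed[OF that]) (use n in \<open>simp add: cyclic_ring_def\<close>)
    ultimately show ?thesis
      using degree_monom_minus_1[OF n, where 'a = 'a]
      by (simp add: cyclic_ring_def mod_poly_less degree_smult_eq)
  qed
  show ?thesis
    unfolding VectorSpace.subspace_def submodule_def
  proof (intro conjI allI impI)
    show "vectorspace class_ring (module_vec TYPE('a) n)" by (rule V.vectorspace_axioms)
    show "Module.module class_ring (module_vec TYPE('a) n)" by (rule V.module_axioms)
    show "cyclic_code n f \<subseteq> carrier (module_vec TYPE('a) n)"
      by (auto simp: cyclic_code_def module_vec_simps)
    show "\<zero>\<^bsub>module_vec TYPE('a) n\<^esub> \<in> cyclic_code n f"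
      unfolding cyclic_code_def module_vec_simps using zero
      by (intro image_eqI[of _ _ 0]) auto
    fix v w assume "v \<in> cyclic_code n f" "w \<in> cyclic_code n f"
    then obtain g h where g: "g \<in> ?I" "h \<in> ?I" "v = vec n (coeff g)" "w = vec n (coeff h)"
      unfolding cyclic_code_def by auto
    show "v \<oplus>\<^bsub>module_vec TYPE('a) n\<^esub> w \<in> cyclic_code n f"
      unfolding cyclic_code_def module_vec_simps
      by (rule image_eqI[OF _ add[OF g(1,2)]]) (auto simp: g(3,4))
  next
    fix c v assume "v \<in> cyclic_code n f"
    then obtain g where g: "g \<in> ?I" "v = vec n (coeff g)"
      unfolding cyclic_code_def by auto
    show "c \<odot>\<^bsub>module_vec TYPE('a) n\<^esub> v \<in> cyclic_code n f"
      unfolding cyclic_code_def module_vec_simps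
      by (rule image_eqI[OF _ scale[OF g(1)]]) (auto simp: g(2))
  qed
qed

end

theory Submission
  imports Defs
begin

text \<open>If \<open>q\<close> is not a primitive root modulo \<open>p\<close>, the powers of \<open>q\<close> modulo \<open>p\<close> form a proper
  subgroup \<open>H\<close> of the multiplicative group, and \<open>e = (\<Sum>i\<in>H. x ^ i)\<close> is fixed by the Frobenius map
  of the ring of polynomials modulo \<open>x ^ p - 1\<close>.  Hence \<open>x ^ p - 1\<close> divides
  \<open>e ^ q - e = (\<Prod>c. e - c)\<close>, which forces \<open>\<Phi> = 1 + x + \<dots> + x ^ (p - 1)\<close> to be reducible: an
  irreducible \<open>\<Phi>\<close> would divide some \<open>e - c\<close>, but \<open>e\<close> has both zero and nonzero coefficients in
  positive degrees below \<open>p\<close>.  The factor \<open>g\<close> of larger degree generates a cyclic code of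
  dimension \<open>K = p - degree g\<close> with \<open>1 < K < p - 1\<close>.  Its minimum distance is at most the weight of
  \<open>g\<close>, so at most \<open>p - K + 1\<close>, and equality is excluded by the MDS conjecture.\<close>

section \<open>Finite fields\<close>

text \<open>Multiplication by a nonzero \<open>x\<close> permutes the nonzero elements, so comparing
  the products of all of them gives \<open>x ^ (CARD('a) - 1) = 1\<close>.\<close>

lemma power_card_field:
  fixes x :: "'a :: {field, finite}"
  shows "x ^ CARD('a) = x"
proof (cases "x = 0")
  case False
  have "bij_betw ((*) x) (UNIV - {0}) (UNIV - {0})"
    by (rule bij_betwI[where g = "\<lambda>y. y / x"]) (use False in auto)
  hence "(\<Prod>y\<in>UNIV - {0}. x * y) = \<Prod>(UNIV - {0})"
    using prod.reindex_bij_betw[of "(*) x" "UNIV - {0}" "UNIV - {0}" "\<lambda>y. y"] by simp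
  hence "x ^ (CARD('a) - 1) = 1"
    by (simp add: prod.distrib)
  hence "x * x ^ (CARD('a) - 1) = x" by simp
  thus ?thesis
    by (simp add: power_eq_if)
qed (simp add: power_0_left)

lemma poly_eq_0_if_vanishes_everywhere:
  fixes f :: "'a :: {field, finite} poly"
  assumes "degree f < CARD('a)" and "\<And>x. poly f x = 0"
  shows "f = 0"
  using assms card_poly_roots_bound[of f] by fastforce

lemma degree_diff_less_same_coeff:
  fixes f g :: "'a :: ab_group_add poly"
  assumes "degree f \<le> n" "degree g \<le> n" "coeff f n = coeff g n" "n > 0"
  shows "degree (f - g) < n"
  using assms by (intro degree_lessI) (auto simp: coeff_eq_0 le_less)

lemma two_le_card_field: "2 \<le> CARD('a :: {field, finite})"
proof -
  have "card {0, 1 :: 'a} \<le> CARD('a)" by (rule card_mono) auto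
  thus ?thesis by simp
qed

text \<open>The polynomial \<open>(x + 1) ^ q - x ^ q - 1\<close> has degree less than \<open>q\<close> and vanishes on the whole
  field, so its coefficients are zero.\<close>

lemma of_nat_card_choose_eq_0:
  assumes "0 < k" "k < CARD('a :: {field, finite})"
  shows "of_nat (CARD('a) choose k) = (0 :: 'a)"
proof -
  let ?q = "CARD('a)"
  define f :: "'a poly" where "f = [:1, 1:] ^ ?q - (monom 1 ?q + 1)"
  have q: "?q > 0" by simp
  have "degree (monom 1 ?q + 1 :: 'a poly) \<le> ?q"
    by (intro degree_add_le) (auto simp: degree_monom_eq)
  moreover have "coeff ([:1, 1:] ^ ?q :: 'a poly) ?q = coeff (monom 1 ?q + 1) ?q"
    by (simp add: coeff_linear_poly_power)
  ultimately have "degree f < ?q"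
    unfolding f_def using q by (intro degree_diff_less_same_coeff) (auto simp: degree_power_eq)
  moreover have "poly f x = 0" for x
    by (simp add: f_def poly_monom power_card_field)
  ultimately have "f = 0"
    by (rule poly_eq_0_if_vanishes_everywhere)
  hence "coeff ([:1, 1:] ^ ?q :: 'a poly) k = coeff (monom 1 ?q + 1) k"
    by (simp add: f_def)
  thus ?thesis
    using assms by (simp add: coeff_linear_poly_power)
qed

text \<open>In the binomial expansion all inner coefficients vanish in the field.\<close>

lemma poly_add_power_card:
  fixes f g :: "'a :: {field, finite} poly"
  shows "(f + g) ^ CARD('a) = f ^ CARD('a) + g ^ CARD('a)"
proof -
  let ?q = "CARD('a)"
  have "(f + g) ^ ?q = (\<Sum>k\<le>?q. of_nat (?q choose k) * f ^ k * g ^ (?q - k))"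
    by (rule binomial_ring)
  also have "\<dots> = (\<Sum>k\<in>{0, ?q}. of_nat (?q choose k) * f ^ k * g ^ (?q - k))"
  proof (intro sum.mono_neutral_right ballI)
    fix k assume "k \<in> {..?q} - {0, ?q}"
    hence "of_nat (?q choose k) = (0 :: 'a)"
      by (intro of_nat_card_choose_eq_0) auto
    hence "of_nat (?q choose k) = (0 :: 'a poly)"
      by (simp add: of_nat_poly)
    thus "of_nat (?q choose k) * f ^ k * g ^ (?q - k) = 0" by simp
  qed auto
  finally show ?thesis by (simp add: add_ac)
qed

lemma poly_sum_power_card:
  fixes f :: "'b \<Rightarrow> 'a :: {field, finite} poly"
  shows "(\<Sum>i\<in>A. f i) ^ CARD('a) = (\<Sum>i\<in>A. f i ^ CARD('a))"
  by (induction A rule: infinite_finite_induct) (auto simp: poly_add_power_card power_0_left)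

lemma pcompose_power:
  fixes f g :: "'a :: comm_semiring_1 poly"
  shows "pcompose (f ^ n) g = pcompose f g ^ n"
  by (induction n) (simp_all add: pcompose_1 pcompose_mult)

text \<open>The identity holds for the indeterminate, because both sides are then monic of degree
  \<open>CARD('a)\<close> and vanish at every field element. Composition with \<open>f\<close> gives
  the general case.\<close>

lemma poly_power_card_minus_self:
  fixes f :: "'a :: {field, finite} poly"
  shows "f ^ CARD('a) - f = (\<Prod>c\<in>UNIV. f - [:c:])"
proof -
  let ?q = "CARD('a)"
  define P Q :: "'a poly" where "P = monom 1 ?q - monom 1 1" and "Q = (\<Prod>c\<in>UNIV. [:- c, 1:])"
  have "degree P \<le> ?q"
    unfolding P_def using two_le_card_field[where 'a = 'a]
    by (intro degree_diff_le) (auto simp: degree_monom_eq)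
  moreover have "coeff P ?q = 1"
    using two_le_card_field[where 'a = 'a] by (simp add: P_def)
  moreover have "degree Q = ?q" by (simp add: Q_def degree_prod_sum_eq)
  moreover have "coeff Q ?q = 1"
    using lead_coeff_prod[of "\<lambda>c. [:- c, 1 :: 'a:]" UNIV] by (simp add: Q_def degree_prod_sum_eq)
  ultimately have "degree (P - Q) < ?q"
    by (intro degree_diff_less_same_coeff) auto
  moreover have "poly (P - Q) x = 0" for x
    by (simp add: P_def Q_def poly_monom power_card_field poly_prod)
  ultimately have "P - Q = 0" by (rule poly_eq_0_if_vanishes_everywhere)
  hence "pcompose P f = pcompose Q f" by simp
  moreover have "pcompose P f = f ^ ?q - f"
    by (simp add: P_def pcompose_diff monom_altdef pcompose_smult pcompose_power pcompose_pCons)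
  moreover have "pcompose Q f = (\<Prod>c\<in>UNIV. f - [:c:])"
    unfolding Q_def pcompose_prod by (intro prod.cong refl) (simp add: pcompose_pCons)
  ultimately show ?thesis by simp
qed

section \<open>Factors of \<open>x ^ p - 1\<close>\<close>

lemma monom_cong_mod:
  fixes n m :: nat
  shows "[monom 1 m = monom (1 :: 'a :: field) (m mod n)] (mod (monom 1 n - 1))"
proof -
  have "monom (1 :: 'a) m = monom 1 n ^ (m div n) * monom 1 (m mod n)"
    by (simp add: monom_power mult_monom)
  moreover have "[monom (1 :: 'a) n ^ (m div n) = 1 ^ (m div n)] (mod (monom 1 n - 1))"
    by (intro cong_pow) (simp add: cong_iff_dvd_diff)
  ultimately show ?thesis
    using cong_mult[of "monom (1 :: 'a) n ^ (m div n)" 1 _ "monom 1 (m mod n)" "monom 1 (m mod n)"]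
    by simp
qed

text \<open>The exponents of \<open>e\<close> form the orbit of 1 under multiplication by
  \<open>q\<close> modulo \<open>n\<close>. The Frobenius map is additive and moves each term to the
  next one in the orbit.\<close>

lemma cyclotomic_coset_dvd:
  fixes n :: nat
  defines "q \<equiv> CARD('a :: {field, finite})"
  defines "e \<equiv> (\<Sum>k<ord n q. monom (1 :: 'a) (q ^ k mod n))"
  shows "monom 1 n - 1 dvd e ^ q - e"
proof -
  let ?M = "monom 1 n - 1 :: 'a poly"
  let ?f = "\<lambda>k. monom (1 :: 'a) (q ^ k mod n)"
  have "[?f k ^ q = ?f (Suc k)] (mod ?M)" for k
  proof -
    have "?f k ^ q = monom 1 (q ^ k mod n * q)"
      by (simp add: monom_power)
    also have "[\<dots> = monom 1 ((q ^ k mod n * q) mod n)] (mod ?M)"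
      by (rule monom_cong_mod)
    also have "(q ^ k mod n * q) mod n = q ^ Suc k mod n"
      by (simp add: mod_mult_right_eq mult.commute)
    finally show ?thesis .
  qed
  hence "[(\<Sum>k<ord n q. ?f k ^ q) = (\<Sum>k<ord n q. ?f (Suc k))] (mod ?M)"
    by (intro cong_sum) auto
  also have "(\<Sum>k<ord n q. ?f (Suc k)) = e"
  proof -
    \<comment> \<open>The orbit closes up. If \<open>q\<close> and \<open>n\<close> are not coprime,
      \<open>ord n q\<close> is 0 and this is trivial.\<close>
    have "?f (ord n q) = ?f 0"
      using ord[of q n] by (simp add: cong_def)
    moreover have "?f 0 + (\<Sum>k<ord n q. ?f (Suc k)) = e + ?f (ord n q)"
      unfolding e_def using sum.lessThan_Suc_shift[of ?f "ord n q"] sum.lessThan_Suc[of ?f "ord n q"]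
      by metis
    ultimately show ?thesis by simp
  qed
  also have "(\<Sum>k<ord n q. ?f k ^ q) = e ^ q"
    by (simp add: e_def q_def poly_sum_power_card)
  finally show ?thesis by (simp add: cong_iff_dvd_diff)
qed

lemma sum_monom_dvd: "(\<Sum>i<n. monom 1 i) dvd (monom 1 n - 1 :: 'a :: field poly)"
proof -
  have "monom 1 n - 1 = (monom 1 1 - 1) * (\<Sum>i<n. monom (1 :: 'a) i)"
    using power_diff_1_eq[of "monom (1 :: 'a) 1" n] by (simp add: monom_power)
  thus ?thesis by simp
qed

lemma not_irreducible_sum_monom:
  fixes p :: nat
  defines "q \<equiv> CARD('a :: {field, finite})"
  assumes p: "prime p" and cop: "coprime p q" and prim: "\<not> residue_primroot p q"
  shows "\<not> irreducible (\<Sum>i<p. monom (1 :: 'a) i)"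
proof
  define e where "e = (\<Sum>k<ord p q. monom (1 :: 'a) (q ^ k mod p))"
  define \<Phi> where "\<Phi> = (\<Sum>i<p. monom (1 :: 'a) i)"
  assume "irreducible (\<Sum>i<p. monom (1 :: 'a) i)"
  hence prime_elem: "prime_elem \<Phi>"
    unfolding \<Phi>_def by (rule field_poly_irreducible_imp_prime)
  have p2: "p \<ge> 2" using p by (rule prime_ge_2_nat)
  have "\<Phi> dvd monom 1 p - 1"
    unfolding \<Phi>_def by (rule sum_monom_dvd)
  also have "monom 1 p - 1 dvd e ^ q - e"
    unfolding e_def q_def by (rule cyclotomic_coset_dvd)
  also have "e ^ q - e = (\<Prod>c\<in>UNIV. e - [:c:])"
    unfolding q_def by (rule poly_power_card_minus_self)
  finally obtain c where "\<Phi> dvd e - [:c:]"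
    using prime_elem_dvd_prod_msetE[OF prime_elem, of "image_mset (\<lambda>c. e - [:c:]) (mset_set UNIV)"]
    by (auto simp: prod_unfold_prod_mset)
  then obtain h where h: "e - [:c:] = \<Phi> * h" ..
  have deg_e: "degree e < p"
    unfolding e_def using p2
    by (intro degree_sum_less) (auto simp: degree_monom_eq)
  have coeff_\<Phi>: "coeff \<Phi> i = (if i < p then 1 else 0)" for i
    by (simp add: \<Phi>_def coeff_sum sum.delta)
  have "degree \<Phi> \<ge> p - 1" by (rule le_degree) (use p2 in \<open>simp add: coeff_\<Phi>\<close>)
  moreover have "degree (e - [:c:]) < p"
    using deg_e p2 by (intro degree_diff_less) auto
  \<comment> \<open>Both degrees are pinned near \<open>p - 1\<close>, so the cofactor is a constant
    \<open>b\<close>; then \<open>e\<close> has coefficient \<open>b\<close> in every degree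
    strictly between 0 and \<open>p\<close>.\<close>
  ultimately have "degree h = 0"
    using p2 unfolding h by (cases "h = 0"; cases "\<Phi> = 0") (auto simp: degree_mult_eq)
  then obtain b where b: "h = [:b:]" by (rule degree_eq_zeroE)
  have coeff_e: "coeff e i = b" if "0 < i" "i < p" for i
    using arg_cong[OF h, of "\<lambda>f. coeff f i"] that by (simp add: b coeff_\<Phi> coeff_pCons split: nat.splits)
  have ord_less: "ord p q < p - 1"
  proof -
    have "ord p q dvd p - 1"
      using order_divides_totient[OF cop] p by (simp add: totient_prime)
    moreover have "ord p q \<noteq> p - 1"
      using prim p cop p2 by (auto simp: residue_primroot_def totient_prime)
    ultimately show ?thesis
      using p2 by (metis dvd_imp_le le_neq_implies_less zero_less_diff less_le_trans one_less_numeral_iff semiring_norm(76))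
  qed
  \<comment> \<open>Pigeonhole: the orbit has fewer than \<open>p - 1\<close> elements. A missed
    exponent forces \<open>b = 0\<close>.\<close>
  have "\<not> {1..<p} \<subseteq> (\<lambda>k. q ^ k mod p) ` {..<ord p q}"
  proof
    assume "{1..<p} \<subseteq> (\<lambda>k. q ^ k mod p) ` {..<ord p q}"
    from surj_card_le[OF _ this] show False using ord_less by simp
  qed
  then obtain i where "i \<in> {1..<p}" and i': "i \<notin> (\<lambda>k. q ^ k mod p) ` {..<ord p q}"
    by blast
  hence i: "0 < i" "i < p" by auto
  have "b = coeff e i" using coeff_e[OF i] by simp
  also have "\<dots> = 0"
    unfolding e_def coeff_sum using i' by (intro sum.neutral) auto
  finally have "b = 0" .
  \<comment> \<open>The powers of \<open>q\<close> below the order are distinct modulo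
    \<open>p\<close>, so the exponent 1 occurs only once; this contradicts
    \<open>b = 0\<close>.\<close>
  have "coeff e 1 = (\<Sum>k<ord p q. if k = 0 then 1 else 0)"
    unfolding e_def coeff_sum
  proof (intro sum.cong refl)
    fix k assume "k \<in> {..<ord p q}"
    hence "q ^ k mod p = 1 \<longleftrightarrow> k = 0"
      using inj_onD[OF inj_power_mod[OF cop], of k 0] p2 cop by auto
    thus "coeff (monom (1 :: 'a) (q ^ k mod p)) 1 = (if k = 0 then 1 else 0)" by simp
  qed
  also have "\<dots> = 1" using cop by (simp add: sum.delta)
  finally show False using coeff_e[of 1] p2 \<open>b = 0\<close> by simp
qed

text \<open>Of two nonconstant factors with degrees adding up to \<open>p - 1\<close>, which is at
  least 4, the one of larger degree satisfies both bounds.\<close>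

lemma exists_factor_monom_minus_1:
  fixes p :: nat
  assumes p: "prime p" "p > CARD('a :: {field, finite}) + 2"
    and prim: "\<not> residue_primroot p CARD('a)"
  obtains g :: "'a :: {field, finite} poly" where "g dvd monom 1 p - 1" "2 \<le> degree g" "degree g \<le> p - 2"
proof -
  define \<Phi> where "\<Phi> = (\<Sum>i<p. monom (1 :: 'a) i)"
  have q: "2 \<le> CARD('a)" by (rule two_le_card_field)
  have "\<not> p dvd CARD('a)" using p q by (auto dest!: dvd_imp_le)
  hence "coprime p CARD('a)" using p(1) by (simp add: prime_imp_coprime)
  hence red: "\<not> irreducible \<Phi>"
    unfolding \<Phi>_def using p prim by (intro not_irreducible_sum_monom) auto
  have coeff_\<Phi>: "coeff \<Phi> i = (if i < p then 1 else 0)" for i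
    by (simp add: \<Phi>_def coeff_sum sum.delta)
  have deg: "degree \<Phi> = p - 1"
  proof (rule antisym)
    show "degree \<Phi> \<le> p - 1" by (rule degree_le) (auto simp: coeff_\<Phi>)
    show "degree \<Phi> \<ge> p - 1" by (rule le_degree) (use p in \<open>simp add: coeff_\<Phi>\<close>)
  qed
  have dvd: "\<Phi> dvd monom 1 p - 1"
    unfolding \<Phi>_def by (rule sum_monom_dvd)
  \<comment> \<open>Zero and units also count as not irreducible, so they are excluded before
    factoring.\<close>
  have "\<Phi> \<noteq> 0" using deg p by auto
  moreover from this have "\<not> is_unit \<Phi>" using deg p by (simp add: is_unit_iff_degree)
  ultimately obtain g h where gh: "\<Phi> = g * h" "\<not> is_unit g" "\<not> is_unit h"
    using red by (auto simp: irreducible_def)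
  have nz: "g \<noteq> 0" "h \<noteq> 0" using deg gh p by auto
  hence pos: "degree g > 0" "degree h > 0" using gh by (auto simp: is_unit_iff_degree)
  have sum: "degree g + degree h = p - 1"
    using deg nz by (simp add: gh degree_mult_eq)
  have dvds: "g dvd monom 1 p - 1" "h dvd monom 1 p - 1"
    using dvd unfolding gh by (auto dest: dvd_mult_left dvd_mult_right)
  show thesis
  proof (cases "degree h \<le> degree g")
    case True
    thus ?thesis using that[of g] pos sum dvds p q by auto
  next
    case False
    thus ?thesis using that[of h] pos sum dvds p q by auto
  qed
qed

section \<open>Cyclic codes generated by a factor of \<open>x ^ n - 1\<close>\<close>

text \<open>Since \<open>g\<close> divides the modulus, reduction preserves divisibility by
  \<open>g\<close>; conversely, a multiple of \<open>g\<close> of degree below \<open>n\<close> is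
  its own remainder.\<close>

lemma genideal_cyclic_ring:
  fixes g :: "'a :: field poly"
  assumes n: "n > 0" and g: "degree g < n" "g dvd monom 1 n - 1"
  shows "genideal (cyclic_ring n) {g} = {f. degree f < n \<and> g dvd f}"
proof -
  let ?R = "cyclic_ring n :: 'a poly ring"
  interpret R: cring ?R by (rule cring_cyclic_ring[OF n])
  have gR: "g \<in> carrier ?R" using g by (simp add: cyclic_ring_def)
  have "genideal ?R {g} = PIdl\<^bsub>?R\<^esub> g"
    using R.cgenideal_eq_genideal[OF gR] by simp
  also have "\<dots> = {f. degree f < n \<and> g dvd f}"
  proof (intro equalityI subsetI)
    fix f assume "f \<in> PIdl\<^bsub>?R\<^esub> g"
    then obtain x where "f = (x * g) mod (monom 1 n - 1)"
      unfolding cgenideal_def by (auto simp: cyclic_ring_def)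
    thus "f \<in> {f. degree f < n \<and> g dvd f}"
      using g degree_mod_monom_minus_1[OF n] by (auto simp: dvd_mod)
  next
    fix f assume "f \<in> {f. degree f < n \<and> g dvd f}"
    then obtain x where f: "f = g * x" "degree f < n" by auto
    show "f \<in> PIdl\<^bsub>?R\<^esub> g"
    proof (cases "f = 0")
      case True
      thus ?thesis
        unfolding cgenideal_def using n by (auto simp: cyclic_ring_def intro!: exI[of _ 0])
    next
      case False
      hence "degree x < n" using f by (auto simp: degree_mult_eq)
      moreover have "f = (x * g) mod (monom 1 n - 1)"
        using f degree_monom_minus_1[OF n, where 'a = 'a] by (simp add: mod_poly_less mult.commute)
      ultimately show ?thesis
        unfolding cgenideal_def by (auto simp: cyclic_ring_def)
    qed
  qed
  finally show ?thesis .
qed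

text \<open>Encoding a message of length \<open>n - degree g\<close> as its product with
  \<open>g\<close> is a linear isomorphism onto the code.\<close>

lemma code_dim_cyclic_code:
  fixes g :: "'a :: field poly"
  assumes n: "n > 0" and g: "degree g < n" "g dvd monom 1 n - 1"
  shows "code_dim n (cyclic_code n g) = n - degree g"
proof -
  let ?k = "n - degree g"
  let ?W = "module_vec TYPE('a) n\<lparr>carrier := cyclic_code n g\<rparr>"
  let ?V = "module_vec TYPE('a) ?k"
  define P :: "'a vec \<Rightarrow> 'a poly" where "P = (\<lambda>v. Poly (list_of_vec v))"
  define T where "T = (\<lambda>v. vec n (coeff (g * P v)))"
  have coeff_P: "coeff (P v) i = (if i < dim_vec v then v $ i else 0)" for v i
    by (simp add: P_def nth_default_def list_of_vec_index)
  have code: "cyclic_code n g = (\<lambda>f. vec n (coeff f)) ` {f. degree f < n \<and> g dvd f}"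
    unfolding cyclic_code_def genideal_cyclic_ring[OF assms] ..
  have "g \<noteq> 0"
    using g(2) degree_monom_minus_1[OF n, where 'a = 'a] n by auto
  have degP: "degree (P v) < ?k" if "v \<in> carrier_vec ?k" for v
  proof -
    have "degree (P v) \<le> ?k - 1"
      by (rule degree_le) (use that in \<open>auto simp: coeff_P\<close>)
    thus ?thesis using g by linarith
  qed
  have deg_gP: "degree (g * P v) < n" if "v \<in> carrier_vec ?k" for v
    using degP[OF that] degree_mult_le[of g "P v"] by linarith
  interpret V: vec_space "TYPE('a)" ?k .
  interpret U: vec_space "TYPE('a)" n .
  interpret W: vectorspace class_ring ?W
    by (rule U.subspace_is_vs[OF subspace_cyclic_code[OF n g(1)]])
  have TW: "T v \<in> carrier ?W" if "v \<in> carrier_vec ?k" for v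
    using deg_gP[OF that] by (auto simp: T_def code)
  have hom: "T \<in> LinearCombinations.module_hom class_ring ?V ?W"
    unfolding LinearCombinations.module_hom_def
  proof (intro CollectI conjI ballI allI impI)
    show "T \<in> carrier ?V \<rightarrow> carrier ?W"
      using TW by (auto simp: module_vec_simps)
  next
    fix v w assume "v \<in> carrier ?V \<and> w \<in> carrier ?V"
    hence "P (v + w) = P v + P w"
      by (intro poly_eqI) (auto simp: coeff_P module_vec_simps)
    thus "T (v \<oplus>\<^bsub>?V\<^esub> w) = T v \<oplus>\<^bsub>?W\<^esub> T w"
      by (auto simp: T_def module_vec_simps distrib_left)
  next
    fix c v assume "c \<in> carrier (class_ring :: 'a ring) \<and> v \<in> carrier ?V"
    hence "P (c \<cdot>\<^sub>v v) = Polynomial.smult c (P v)"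
      by (intro poly_eqI) (auto simp: coeff_P module_vec_simps)
    thus "T (c \<odot>\<^bsub>?V\<^esub> v) = c \<odot>\<^bsub>?W\<^esub> T v"
      by (auto simp: T_def module_vec_simps)
  qed
  interpret T: linear_map class_ring ?V ?W T
    by unfold_locales (rule hom)
  have inj: "inj_on T (carrier ?V)"
  proof (rule inj_onI)
    fix v w assume vw: "v \<in> carrier ?V" "w \<in> carrier ?V" "T v = T w"
    hence vk: "v \<in> carrier_vec ?k" "w \<in> carrier_vec ?k" by (auto simp: module_vec_simps)
    have "coeff (g * P v) i = coeff (g * P w) i" for i
    \<comment> \<open>\<open>T\<close> records only the coefficients below \<open>n\<close>; the
      others vanish by the degree bound.\<close>
    proof (cases "i < n")
      case True
      thus ?thesis using arg_cong[OF vw(3), of "\<lambda>u. u $ i"] by (simp add: T_def)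
    next
      case False
      thus ?thesis using deg_gP[OF vk(1)] deg_gP[OF vk(2)] by (simp add: coeff_eq_0)
    qed
    hence "g * P v = g * P w" by (rule poly_eqI)
    hence "P v = P w" using \<open>g \<noteq> 0\<close> by simp
    thus "v = w"
      using vk by (intro eq_vecI) (metis coeff_P carrier_vecD, auto)
  qed
  have surj: "T ` carrier ?V = carrier ?W"
  proof (intro equalityI subsetI)
    fix u assume "u \<in> carrier ?W"
    then obtain h where h: "u = vec n (coeff (g * h))" "degree (g * h) < n"
      by (auto simp: code)
    have "degree h < ?k"
      using h(2) \<open>g \<noteq> 0\<close> g(1) by (cases "h = 0") (auto simp: degree_mult_eq)
    hence "P (vec ?k (coeff h)) = h"
      by (intro poly_eqI) (auto simp: coeff_P coeff_eq_0)
    hence "u = T (vec ?k (coeff h))" by (simp add: T_def h)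
    thus "u \<in> T ` carrier ?V" by (auto simp: module_vec_simps)
  qed (use TW in \<open>auto simp: module_vec_simps\<close>)
  show ?thesis
    using T.dim_eq[OF V.fin_dim inj surj] V.dim_is_n by (simp add: code_dim_def)
qed

text \<open>The generator is itself a nonzero codeword, with nonzero entries only at positions up to
  \<open>degree g\<close>.\<close>

lemma min_distance_cyclic_code_le:
  fixes g :: "'a :: field poly"
  assumes g: "degree g < n" "g dvd monom 1 n - 1"
  shows "min_distance (cyclic_code n g) \<le> degree g + 1"
proof -
  let ?v = "vec n (coeff g)"
  have n: "n > 0" using g by simp
  have "g \<noteq> 0"
    using g(2) degree_monom_minus_1[OF n, where 'a = 'a] n by auto
  hence "?v $ degree g \<noteq> 0\<^sub>v n $ degree g" using g by simp
  hence "?v \<noteq> 0\<^sub>v (dim_vec ?v)" by auto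
  moreover have "?v \<in> cyclic_code n g"
    unfolding cyclic_code_def genideal_cyclic_ring[OF n g] using g by auto
  ultimately have "min_distance (cyclic_code n g) \<le> hamming_weight ?v"
    unfolding min_distance_def by (intro cInf_lower) auto
  also have "\<dots> \<le> card {..degree g}"
    unfolding hamming_weight_def by (intro card_mono) (auto intro: le_degree)
  finally show ?thesis by simp
qed

theorem theorem1:
  fixes q p :: nat
  assumes "CARD('a :: {field, finite}) = q" and "prime p"
    and MDS_conjecture: "\<forall>N K D (C :: 'a vec set).
          linear_code N K D C \<and> D = N - K + 1 \<and> 1 < K \<and> K < N - 1 \<longrightarrow> N \<le> q + 2"
    and "\<not> residue_primroot p q" and "p > q + 2"
  shows "\<mu> TYPE('a) p \<le> p"
proof -
  obtain g :: "'a poly" where g: "g dvd monom 1 p - 1" "2 \<le> degree g" "degree g \<le> p - 2"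
    by (rule exists_factor_monom_minus_1[of p]) (use assms(1,2,4,5) in auto)
  have p: "p > 2" using assms(5) by simp
  hence deg: "degree g < p" using g by linarith
  let ?C = "cyclic_code p g"
  let ?K = "p - degree g"
  have dim: "code_dim p ?C = ?K"
    using p deg g by (intro code_dim_cyclic_code) auto
  have "linear_code p ?K (min_distance ?C) ?C"
    using subspace_cyclic_code[of p g] p deg dim by (simp add: linear_code_def)
  moreover have "1 < ?K" "?K < p - 1" using g p by auto
  \<comment> \<open>Equality would make the code MDS and force \<open>p \<le> q + 2\<close>.\<close>
  ultimately have "min_distance ?C \<noteq> p - ?K + 1"
    using MDS_conjecture[rule_format, of p ?K "min_distance ?C" ?C] assms(5) by auto
  \<comment> \<open>Here \<open>p - ?K + 1\<close> is \<open>degree g + 1\<close>, the upper bound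
    on the distance, so excluding equality gains the decisive 1.\<close>
  with min_distance_cyclic_code_le[OF deg g(1)] deg
  have "min_distance ?C + code_dim p ?C \<le> p" by (simp add: dim)
  moreover have "\<mu> TYPE('a) p \<le> min_distance ?C + code_dim p ?C"
    unfolding \<mu>_def using deg g(2)
    by (intro cInf_lower) (auto simp: cyclic_ring_def intro!: exI[of _ g])
  ultimately show ?thesis by simp
qed

end
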